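(* For nonnegative integers $n,k$ let $s(n,k)$ be the number of natural tests with cost $n$ and exactly $k$ distinct valid answers. Then, as formal power series, $$\mathcal{S}(x,y)=\sum_{n,k\ge 0}s(n,k)\,x^n y^k=\prod_{i=1}^{\infty}\left(\frac{1}{1-x^i}+(y-1)x^{i^2}\right).$$
   Context: A natural test is a finite multiset of positive integers (its answers; order is irrelevant). The empty test is allowed and has cost $0$. The cost of a test is the sum of all its answers with multiplicity, so a natural test of cost $n$ is a partition of $n$. A positive integer $a$ is a valid answer of a natural test if $a$ appears in the test exactly $a$ times. *)

theory Defs
  imports
    "HOL-Analysis.Analysis"
    "HOL-Library.Multiset"
    "HOL-Computational_Algebra.Formal_Power_Series"
begin

definition natural_test :: "nat multiset \<Rightarrow> bool" where
  "natural_test T \<longleftrightarrow> (\<forall>a\<in>#T. 0 < a)"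

definition cost :: "nat multiset \<Rightarrow> nat" where
  "cost T = sum_mset T"

text \<open>The guard \<open>0 < a\<close> matters: \<open>count T 0 = 0\<close> holds in every natural test.\<close>

definition valid_answer :: "nat multiset \<Rightarrow> nat \<Rightarrow> bool" where
  "valid_answer T a \<longleftrightarrow> 0 < a \<and> count T a = a"

definition s :: "nat \<Rightarrow> nat \<Rightarrow> nat" where
  "s n k = card {T. natural_test T \<and> cost T = n \<and> card {a. valid_answer T a} = k}"

text \<open>
  Both cardinalities in the definition of \<open>s\<close> are cardinalities of finite sets.
\<close>

lemma finite_natural_tests: "finite {T. natural_test T \<and> cost T = n}"
proof (rule finite_subset)
  have size_le: "size T \<le> sum_mset T" if "\<forall>a\<in>#T. 0 < a" for T :: "nat multiset"
    using that by (induction T) auto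
  have elem_le: "a \<le> sum_mset T" if "a \<in># T" for a and T :: "nat multiset"
    using that by (metis le_add1 sum_mset.remove)
  show "{T. natural_test T \<and> cost T = n} \<subseteq> mset ` {xs. set xs \<subseteq> {..n} \<and> length xs \<le> n}"
  proof
    fix T assume "T \<in> {T. natural_test T \<and> cost T = n}"
    then have T: "\<forall>a\<in>#T. 0 < a" "sum_mset T = n"
      by (auto simp: natural_test_def cost_def)
    obtain xs where xs: "mset xs = T"
      using ex_mset by blast
    have "set xs \<subseteq> {..n}"
      using elem_le T(2) by (auto simp flip: xs)
    moreover have "length xs \<le> n"
      using size_le[OF T(1)] T(2) by (metis size_mset xs)
    ultimately show "T \<in> mset ` {xs. set xs \<subseteq> {..n} \<and> length xs \<le> n}"
      using xs by blast
  qed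
  show "finite (mset ` {xs::nat list. set xs \<subseteq> {..n} \<and> length xs \<le> n})"
    by (intro finite_imageI finite_lists_length_le) simp
qed

lemma finite_valid_answers: "finite {a. valid_answer T a}"
  by (rule finite_subset[of _ "set_mset T"]) (auto simp: valid_answer_def simp flip: count_greater_zero_iff)

text \<open>
  Power series in \<open>x\<close> and \<open>y\<close> are power series in \<open>x\<close> whose coefficients are power series
  in \<open>y\<close>.  The coefficients are rational only so that the library's division of power series
  applies; division by \<open>1 - x ^ i\<close> with \<open>i > 0\<close> is multiplication by its inverse.
  The topology of \<^typ>\<open>rat fps fps\<close>, in which infinite products are taken, is the \<open>x\<close>-adic
  one: a sequence converges iff each coefficient of a power of \<open>x\<close>, itself a series in \<open>y\<close>, is
  eventually constant.
\<close>

type_synonym bifps = "rat fps fps"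

definition x_var :: bifps where
  "x_var = fps_X"

definition y_var :: bifps where
  "y_var = fps_const fps_X"

definition S_series :: bifps where
  "S_series = Abs_fps (\<lambda>n. Abs_fps (\<lambda>k. of_nat (s n k)))"

end

theory Submission
  imports Defs
begin

text \<open>
  Choosing a natural test amounts to choosing, independently for every positive integer \<open>i\<close>, how
  often \<open>i\<close> occurs.  If \<open>i\<close> occurs \<open>c\<close> times it contributes \<open>x ^ (c * i)\<close>, and an additional factor
  \<open>y\<close> precisely when \<open>c = i\<close>.  So the contribution of \<open>i\<close> is the geometric series
  \<open>1 / (1 - x ^ i)\<close> in which the single term \<open>x ^ (i * i)\<close> has been given the coefficient \<open>y\<close>,
  which is the \<open>i\<close>-th factor of the product.

  This is made precise by \<open>nth_prod_eq_sum_partitions\<close>, which expands a finite product of such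
  factors, with arbitrary weights attached to the multiplicities, as a sum over
  partitions.  The coefficient of \<open>x ^ n\<close> involves partitions of \<open>n\<close> only, whose parts are at most
  \<open>n\<close>; hence it is the same for all partial products that contain the first \<open>n\<close> factors, and the
  product converges coefficientwise.
\<close>

text \<open>
  The coefficient of \<open>x ^ n\<close> in a finite product of power series is a sum over multisets \<open>X\<close> of
  size \<open>n\<close> of indices, where \<open>count X i\<close> is the exponent taken from the factor \<open>i\<close>.  The
  partition \<open>T\<close> takes the exponent \<open>i * count T i\<close> there, and \<open>repeat_parts T\<close> is the multiset
  with these multiplicities.
\<close>

definition repeat_parts :: "nat multiset \<Rightarrow> nat multiset" where
  "repeat_parts T = (\<Sum>a\<in>#T. replicate_mset a a)"

lemma count_repeat_parts: "count (repeat_parts T) i = i * count T i"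
  by (induction T) (auto simp: repeat_parts_def)

lemma size_repeat_parts: "size (repeat_parts T) = sum_mset T"
  by (induction T) (auto simp: repeat_parts_def)

lemma set_mset_repeat_parts: "set_mset (repeat_parts T) \<subseteq> set_mset T"
  by (induction T) (auto simp: repeat_parts_def)

lemma repeat_parts_surj:
  assumes "finite A" and "set_mset X \<subseteq> A" and "\<And>i. i \<in> A \<Longrightarrow> i dvd count X i"
  obtains T where "set_mset T \<subseteq> A" and "repeat_parts T = X"
proof
  let ?T = "\<Sum>i\<in>A. replicate_mset (count X i div i) i"
  have count: "count ?T j = (if j \<in> A then count X j div j else 0)" for j
    using assms(1) by (simp add: count_sum if_distrib cong: if_cong)
  show "set_mset ?T \<subseteq> A"
  proof
    fix j assume "j \<in># ?T"
    then show "j \<in> A"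
      unfolding count_greater_zero_iff[symmetric] count by (simp split: if_splits)
  qed
  show "repeat_parts ?T = X"
  proof (rule multiset_eqI)
    fix j
    have "count X j = 0" if "j \<notin> A"
      using assms(2) that by (meson not_in_iff subsetD)
    then show "count (repeat_parts ?T) j = count X j"
      unfolding count_repeat_parts count using assms(3)[of j] by simp
  qed
qed

lemma inj_on_repeat_parts:
  assumes "0 \<notin> A"
  shows "inj_on repeat_parts {T. set_mset T \<subseteq> A}"
proof (rule inj_onI, rule multiset_eqI)
  fix S T i
  assume sub: "S \<in> {T. set_mset T \<subseteq> A}" "T \<in> {T. set_mset T \<subseteq> A}"
    and "repeat_parts S = repeat_parts T"
  then have "i * count S i = i * count T i"
    by (metis count_repeat_parts)
  moreover have "count S 0 = 0" "count T 0 = 0"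
    using sub assms by (auto simp: count_eq_zero_iff)
  ultimately show "count S i = count T i"
    by (cases "i = 0") auto
qed

text \<open>
  The coefficient of \<open>x ^ n\<close> in the product distributes \<open>n\<close> over the factors.  A nonzero
  contribution requires each \<open>i\<close> to receive a multiple of \<open>i\<close>, and such distributions are
  exactly the multisets \<open>repeat_parts T\<close>.
\<close>

lemma nth_prod_eq_sum_partitions:
  fixes f :: "nat \<Rightarrow> 'a::comm_semiring_1 fps" and w :: "nat \<Rightarrow> nat \<Rightarrow> 'a"
  assumes "finite A" and "0 \<notin> A"
    and factor: "\<And>i m. i \<in> A \<Longrightarrow> fps_nth (f i) m = (if i dvd m then w i (m div i) else 0)"
  shows "fps_nth (\<Prod>i\<in>A. f i) n =
    (\<Sum>T | set_mset T \<subseteq> A \<and> sum_mset T = n. \<Prod>i\<in>A. w i (count T i))"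
proof -
  let ?P = "{T. set_mset T \<subseteq> A \<and> sum_mset T = n}"
  let ?D = "{X \<in> multisets_of_size A n. \<forall>i\<in>A. i dvd count X i}"
  have inj: "inj_on repeat_parts ?P"
    by (rule inj_on_subset[OF inj_on_repeat_parts[OF assms(2)]]) auto
  have image: "repeat_parts ` ?P = ?D"
  proof (intro equalityI subsetI)
    fix X assume "X \<in> repeat_parts ` ?P"
    then show "X \<in> ?D"
      using set_mset_repeat_parts
      by (fastforce simp: multisets_of_size_def size_repeat_parts count_repeat_parts)
  next
    fix X assume "X \<in> ?D"
    then have X: "set_mset X \<subseteq> A" "size X = n" "\<And>i. i \<in> A \<Longrightarrow> i dvd count X i"
      by (auto simp: multisets_of_size_def)
    then obtain T where "set_mset T \<subseteq> A" "repeat_parts T = X"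
      using repeat_parts_surj[OF assms(1)] by metis
    then show "X \<in> repeat_parts ` ?P"
      using X(2) by (auto simp flip: size_repeat_parts)
  qed
  have "fps_nth (\<Prod>i\<in>A. f i) n = (\<Sum>X\<in>multisets_of_size A n. \<Prod>i\<in>A. fps_nth (f i) (count X i))"
    by (rule fps_prod_nth'[OF assms(1)])
  also have "\<dots> = (\<Sum>X\<in>?D. \<Prod>i\<in>A. fps_nth (f i) (count X i))"
  proof (rule sum.mono_neutral_right)
    show "\<forall>X\<in>multisets_of_size A n - ?D. (\<Prod>i\<in>A. fps_nth (f i) (count X i)) = 0"
      using assms(1) by (auto simp: factor intro!: prod_zero)
  qed (use assms(1) in auto)
  also have "\<dots> = (\<Sum>T\<in>?P. \<Prod>i\<in>A. fps_nth (f i) (count (repeat_parts T) i))"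
    by (simp add: sum.reindex[OF inj] flip: image)
  also have "\<dots> = (\<Sum>T\<in>?P. \<Prod>i\<in>A. w i (count T i))"
    using assms(2) by (intro sum.cong prod.cong refl) (auto simp: factor count_repeat_parts)
  finally show ?thesis .
qed

text \<open>
  In a bivariate series the coefficients of the powers of \<open>x\<close> are themselves power series, which
  do not form a division ring.  Since the constant coefficient of \<open>1 - x ^ i\<close> is \<open>1\<close>, division by
  \<open>1 - x ^ i\<close> behaves as expected as soon as \<open>inverse\<close> is correct at \<open>1\<close>.
\<close>

lemma divide_one_minus_X_power:
  fixes i :: nat
  assumes "i > 0" and "inverse (1::'a::{comm_ring_1, inverse}) = 1"
  shows "1 / (1 - fps_X ^ i) = Abs_fps (\<lambda>m. if i dvd m then 1 else 0 :: 'a)"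
proof -
  let ?g = "1 - fps_X ^ i :: 'a fps" and ?G = "Abs_fps (\<lambda>m. if i dvd m then 1 else 0 :: 'a)"
  have g0: "fps_nth ?g 0 = 1"
    using assms(1) by simp
  have prod: "?g * ?G = 1"
  proof (rule fps_ext)
    fix m
    have "fps_nth (?g * ?G) m = fps_nth ?G m - (if m < i then 0 else fps_nth ?G (m - i))"
      by (simp add: left_diff_distrib fps_X_power_mult_nth)
    also have "\<dots> = fps_nth 1 m"
      using assms(1) by (auto simp: dvd_minus_self intro: ccontr dest: dvd_imp_le)
    finally show "fps_nth (?g * ?G) m = fps_nth 1 m" .
  qed
  have "inverse ?g = fps_right_inverse ?g (fps_nth ?G 0)"
    using g0 assms(2) by (simp add: fps_inverse_def)
  also have "\<dots> = ?G"
    by (rule fps_lr_inverse_unique_ring1(2)[OF prod]) (use g0 in simp)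
  finally have "inverse ?g = ?G" .
  moreover have "subdegree ?g = 0"
    using g0 by (intro subdegree_eq_0) simp
  ultimately show ?thesis
    by (simp add: fps_divide_unit')
qed

lemma nth_factor:
  assumes "i > 0"
  shows "fps_nth (1 / (1 - x_var ^ i) + (y_var - 1) * x_var ^ i\<^sup>2) m =
    (if i dvd m then if m div i = i then fps_X else 1 else 0)"
proof -
  have "m = i\<^sup>2 \<longleftrightarrow> i dvd m \<and> m div i = i"
    using assms by (auto simp: power2_eq_square)
  moreover have "fps_nth ((y_var - 1) * x_var ^ i\<^sup>2) m = (if m = i\<^sup>2 then fps_X - 1 else 0)"
    unfolding x_var_def y_var_def by (auto simp: fps_X_power_mult_right_nth)
  ultimately show ?thesis
    using assms by (auto simp: divide_one_minus_X_power x_var_def fps_inverse_one')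
qed

lemma prod_valid_weights:
  assumes "finite A" and "0 \<notin> A" and "set_mset T \<subseteq> A"
  shows "(\<Prod>i\<in>A. if count T i = i then z else 1) =
    (z::'a::comm_monoid_mult) ^ card {a. valid_answer T a}"
proof -
  have "{i \<in> A. count T i = i} = {a. valid_answer T a}"
    using assms(2,3) by (auto simp: valid_answer_def intro!: gr0I simp flip: count_greater_zero_iff)
  then show ?thesis
    using assms(1) by (simp flip: prod.inter_filter)
qed

lemma nth_S_series:
  "fps_nth S_series n = (\<Sum>T | natural_test T \<and> cost T = n. fps_X ^ card {a. valid_answer T a})"
proof (rule fps_ext)
  fix k
  let ?v = "\<lambda>T. card {a. valid_answer T a}" and ?tests = "{T. natural_test T \<and> cost T = n}"
  have "fps_nth (fps_nth S_series n) k = (\<Sum>T | T \<in> ?tests \<and> ?v T = k. 1)"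
    by (simp add: S_series_def s_def)
  also have "\<dots> = (\<Sum>T\<in>?tests. if ?v T = k then 1 else 0)"
    by (rule sum.inter_filter[OF finite_natural_tests])
  also have "\<dots> = fps_nth (\<Sum>T\<in>?tests. fps_X ^ ?v T) k"
    unfolding fps_sum_nth by (intro sum.cong) auto
  finally show "fps_nth (fps_nth S_series n) k = fps_nth (\<Sum>T\<in>?tests. fps_X ^ ?v T) k" .
qed

text \<open>
  A convergent infinite product is required to have a nonzero limit, unless a factor vanishes.
  Here the empty test contributes the constant term.
\<close>

lemma S_series_nonzero: "S_series \<noteq> 0"
proof
  assume "S_series = 0"
  then have "s 0 0 = 0"
    unfolding S_series_def by (auto simp: fps_eq_iff)
  moreover have "T = {#}" if "natural_test T" "cost T = 0" for T
    using that by (cases T) (auto simp: natural_test_def cost_def)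
  then have "{T. natural_test T \<and> cost T = 0 \<and> card {a. valid_answer T a} = 0} = {{#}}"
    by (auto simp: natural_test_def cost_def valid_answer_def)
  ultimately show False
    by (simp add: s_def)
qed

theorem corollary3:
  shows "(\<lambda>i. 1 / (1 - x_var ^ Suc i) + (y_var - 1) * x_var ^ ((Suc i)\<^sup>2)) has_prod S_series"
proof -
  define f where "f i = 1 / (1 - x_var ^ i) + (y_var - 1) * x_var ^ i\<^sup>2" for i
  have "fps_nth (\<Prod>i\<le>N. f (Suc i)) n = fps_nth S_series n" if "n \<le> N" for n N
  proof -
    let ?A = "{1..Suc N}"
    have tests: "{T. set_mset T \<subseteq> ?A \<and> sum_mset T = n} = {T. natural_test T \<and> cost T = n}"
    proof -
      have "a \<le> Suc N" if "a \<in># T" "sum_mset T = n" for a T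
        using that \<open>n \<le> N\<close> by (metis le_add1 le_Suc_eq le_trans sum_mset.remove)
      then show ?thesis
        by (fastforce simp: natural_test_def cost_def Suc_le_eq)
    qed
    have "(\<Prod>i\<le>N. f (Suc i)) = prod f ?A"
      by (simp add: prod.atLeast1_atMost_eq flip: lessThan_Suc_atMost)
    also have "fps_nth (prod f ?A) n = (\<Sum>T | set_mset T \<subseteq> ?A \<and> sum_mset T = n.
        \<Prod>i\<in>?A. if count T i = i then fps_X else 1)"
    proof (rule nth_prod_eq_sum_partitions)
      show "fps_nth (f i) m = (if i dvd m then if m div i = i then fps_X else 1 else 0)"
        if "i \<in> ?A" for i m
        unfolding f_def using that by (intro nth_factor) simp
    qed simp_all
    also have "\<dots> = (\<Sum>T | natural_test T \<and> cost T = n. fps_X ^ card {a. valid_answer T a})"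
    proof (rule sum.cong[OF tests])
      fix T assume "T \<in> {T. natural_test T \<and> cost T = n}"
      then have "set_mset T \<subseteq> ?A"
        using tests by blast
      then show "(\<Prod>i\<in>?A. if count T i = i then fps_X else 1) = fps_X ^ card {a. valid_answer T a}"
        by (intro prod_valid_weights) simp_all
    qed
    finally show ?thesis
      by (simp only: nth_S_series)
  qed
  then have "(\<lambda>N. \<Prod>i\<le>N. f (Suc i)) \<longlonglongrightarrow> S_series"
    by (intro tendsto_fpsI eventually_sequentiallyI)
  then show ?thesis
    using S_series_nonzero by (simp add: has_prod_def raw_has_prod_def f_def)
qed

end
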